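(* If $w_{\text{lim}}=1$, the following two optimization problems, in the decision variables $(u_k,r_{\text{u},k},r_{\text{d},k})_{k=0}^{N_1-1}$ with $r_{\text{u},k},r_{\text{d},k}\ge 0$, are equivalent. Problem (Q): minimize $$\sum_{k=0}^{N_1-1}\big[c_k f(u_k)-\lambda_k(R_{\text{d},k}+R_{\text{u},k})\big]$$ subject to $u_{\min}\le u_k-r_{\text{d},k}$ and $u_k+r_{\text{u},k}\le u_{\max}$ for all $k$, and $x_{\min,k}\le\underline x_k$ and $\overline x_k\le x_{\max,k}$ for all $k$, where $\overline x_0=\underline x_0=x_0$ and $$\overline x_{k+1}=A\overline x_k+B_uT_{\text{s}}\, f^{-1}(P_k-w_{\text{lim}}R_{\text{u},k})+B_{xu}\overline x_k\, f^{-1}(P_k-w_{\text{lim}}R_{\text{u},k})+B_vv_k,$$ $$\underline x_{k+1}=A\underline x_k+B_uT_{\text{s}}\, f^{-1}(P_k+w_{\text{lim}}R_{\text{d},k})+B_{xu}\underline x_k\, f^{-1}(P_k+w_{\text{lim}}R_{\text{d},k})+B_vv_k.$$ Problem (Q'): the same problem with the dynamics replaced by $$\overline x_{k+1}=A\overline x_k+B_uT_{\text{s}}(u_k-w_{\text{lim}}r_{\text{d},k})+B_{xu}\overline x_k(u_k-w_{\text{lim}}r_{\text{d},k})+B_vv_k,$$ $$\underline x_{k+1}=A\underline x_k+B_uT_{\text{s}}(u_k+w_{\text{lim}}r_{\text{u},k})+B_{xu}\underline x_k(u_k+w_{\text{lim}}r_{\text{u},k})+B_vv_k.$$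
   Context: "Equivalent" means that the two problems have the same objective function and the same set of feasible decisions $(u_k,r_{\text{u},k},r_{\text{d},k})_k$. Fan curve: $f(u)=\alpha_3u^3+\alpha_2u^2+\alpha_1u+\alpha_0$ with $\alpha_3=2588.2$, $\alpha_2=-1458.0$, $\alpha_1=630.9$, $\alpha_0=28.7$. This is a strictly increasing bijection of $\mathbb{R}$, with inverse $f^{-1}$. It maps air mass flow rate $u$ to fan power. Notation: $P_k=f(u_k)$; $R_{\text{u},k}=f(u_k)-f(u_k-r_{\text{d},k})$ and $R_{\text{d},k}=f(u_k+r_{\text{u},k})-f(u_k)$. Flow bounds: $u_{\min}=h(20)$ and $u_{\max}=h(80)$, where $h(N)=0.0133N+0.0606$, i.e. $u_{\min}=0.3266$, $u_{\max}=1.1246$. Building model: the state is $x_k=(T_{\text{r},k},T_{\text{m},k})^\top\in\mathbb{R}^2$ (room temperature and thermal mass temperature), $v_k\in\mathbb{R}^3$ is a given disturbance, and $$A=\begin{bmatrix} a_{11} & a_{12} \\ a_{21} & a_{22} \end{bmatrix},\quad B_u=\begin{bmatrix} b \\ 0 \end{bmatrix},\quad B_{xu}=\begin{bmatrix} -b & 0 \\ 0 & 0 \end{bmatrix},\quad B_v=\begin{bmatrix} d_{11} & d_{12} & d_{13} \\ 0 & 0 & 0 \end{bmatrix},$$ where $a_{ij},b,d_{1j}$ are given real model parameters. $T_{\text{s}}$ is the constant supply air temperature. $c_k,\lambda_k$ are given real prices and $x_0$ is a given initial state. The bounds $x_{\min,k},x_{\max,k}\in\mathbb{R}$ constrain only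 the first component (room temperature) of the state. Dynamics are imposed for $k=0,\dots,N_1-1$ and temperature constraints for $k=0,\dots,N_1$; the flow constraints are for $k=0,\dots,N_1-1$. *)

theory Defs
  imports "HOL-Analysis.Analysis"
begin

record 'd minimization =
  objective :: "'d \<Rightarrow> real"
  feasible :: "'d set"

definition equivalent :: "'d minimization \<Rightarrow> 'd minimization \<Rightarrow> bool" where
  "equivalent p q \<longleftrightarrow> objective p = objective q \<and> feasible p = feasible q"

text \<open>\<open>fan\<close> is a strictly increasing bijection of the reals, so \<open>inv fan\<close> below is its
  genuine inverse.\<close>

definition fan :: "real \<Rightarrow> real" where
  "fan u = 2588.2 * u ^ 3 + (- 1458.0) * u ^ 2 + 630.9 * u + 28.7"

definition flow_of_speed :: "real \<Rightarrow> real" where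
  "flow_of_speed N = 0.0133 * N + 0.0606"

definition u_min :: real where
  "u_min = flow_of_speed 20"

definition u_max :: real where
  "u_max = flow_of_speed 80"

record building =
  a11 :: real
  a12 :: real
  a21 :: real
  a22 :: real
  b :: real
  d11 :: real
  d12 :: real
  d13 :: real

definition A_mat :: "building \<Rightarrow> real^2^2" where
  "A_mat M = vector [vector [a11 M, a12 M], vector [a21 M, a22 M]]"

definition B_u :: "building \<Rightarrow> real^2" where
  "B_u M = vector [b M, 0]"

definition B_xu :: "building \<Rightarrow> real^2^2" where
  "B_xu M = vector [vector [- b M, 0], vector [0, 0]]"

definition B_v :: "building \<Rightarrow> real^3^2" where
  "B_v M = vector [vector [d11 M, d12 M, d13 M], vector [0, 0, 0]]"

record scenario =
  model :: building
  horizon :: nat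
  supply_temp :: real
  price :: "nat \<Rightarrow> real"
  reserve_price :: "nat \<Rightarrow> real"
  initial :: "real^2"
  disturbance :: "nat \<Rightarrow> real^3"
  temp_min :: "nat \<Rightarrow> real"
  temp_max :: "nat \<Rightarrow> real"

text \<open>State trajectory under the air mass flow rates \<open>q\<close>. Only its values up to
  the horizon, hence only the rates before the horizon, enter the constraints below.\<close>

primrec trajectory :: "scenario \<Rightarrow> (nat \<Rightarrow> real) \<Rightarrow> nat \<Rightarrow> real^2" where
  "trajectory S q 0 = initial S"
| "trajectory S q (Suc k) =
     A_mat (model S) *v trajectory S q k
     + (supply_temp S * q k) *\<^sub>R B_u (model S)
     + q k *\<^sub>R (B_xu (model S) *v trajectory S q k)
     + B_v (model S) *v disturbance S k"

text \<open>A decision is \<open>(u, ru, rd)\<close>. Finite sequences indexed by \<open>k < N\<close> are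
  functions that are \<open>undefined\<close> outside \<open>{..<N}\<close>.\<close>

type_synonym decision = "(nat \<Rightarrow> real) \<times> (nat \<Rightarrow> real) \<times> (nat \<Rightarrow> real)"

definition decisions :: "nat \<Rightarrow> decision set" where
  "decisions N = ({..<N} \<rightarrow>\<^sub>E UNIV) \<times> ({..<N} \<rightarrow>\<^sub>E {0..}) \<times> ({..<N} \<rightarrow>\<^sub>E {0..})"

text \<open>Reducing the flow by \<open>rd\<close> lowers the fan power, which is an up-reserve for the grid;
  so \<open>R_up\<close> depends on \<open>rd\<close> and \<open>R_down\<close> on \<open>ru\<close>.\<close>

fun R_up :: "decision \<Rightarrow> nat \<Rightarrow> real" where
  "R_up (u, ru, rd) k = fan (u k) - fan (u k - rd k)"

fun R_down :: "decision \<Rightarrow> nat \<Rightarrow> real" where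
  "R_down (u, ru, rd) k = fan (u k + ru k) - fan (u k)"

fun fan_power :: "decision \<Rightarrow> nat \<Rightarrow> real" where
  "fan_power (u, ru, rd) k = fan (u k)"

definition total_cost :: "scenario \<Rightarrow> decision \<Rightarrow> real" where
  "total_cost S z =
     (\<Sum>k<horizon S. price S k * fan_power z k - reserve_price S k * (R_down z k + R_up z k))"

fun flow_constraints :: "scenario \<Rightarrow> decision \<Rightarrow> bool" where
  "flow_constraints S (u, ru, rd) \<longleftrightarrow>
     (\<forall>k<horizon S. u_min \<le> u k - rd k \<and> u k + ru k \<le> u_max)"

text \<open>\<open>x_up\<close> and \<open>x_low\<close> are the overlined and the underlined state trajectories.
  The bounds apply to the room temperature, the first state component.\<close>

definition temp_constraints ::
  "scenario \<Rightarrow> (nat \<Rightarrow> real^2) \<Rightarrow> (nat \<Rightarrow> real^2) \<Rightarrow> bool" where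
  "temp_constraints S x_up x_low \<longleftrightarrow>
     (\<forall>k\<le>horizon S. temp_min S k \<le> x_low k $ 1 \<and> x_up k $ 1 \<le> temp_max S k)"

definition x_up_Q :: "scenario \<Rightarrow> real \<Rightarrow> decision \<Rightarrow> nat \<Rightarrow> real^2" where
  "x_up_Q S w_lim z = trajectory S (\<lambda>k. inv fan (fan_power z k - w_lim * R_up z k))"

definition x_low_Q :: "scenario \<Rightarrow> real \<Rightarrow> decision \<Rightarrow> nat \<Rightarrow> real^2" where
  "x_low_Q S w_lim z = trajectory S (\<lambda>k. inv fan (fan_power z k + w_lim * R_down z k))"

fun x_up_Q' :: "scenario \<Rightarrow> real \<Rightarrow> decision \<Rightarrow> nat \<Rightarrow> real^2" where
  "x_up_Q' S w_lim (u, ru, rd) = trajectory S (\<lambda>k. u k - w_lim * rd k)"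

fun x_low_Q' :: "scenario \<Rightarrow> real \<Rightarrow> decision \<Rightarrow> nat \<Rightarrow> real^2" where
  "x_low_Q' S w_lim (u, ru, rd) = trajectory S (\<lambda>k. u k + w_lim * ru k)"

definition problem_Q :: "scenario \<Rightarrow> real \<Rightarrow> decision minimization" where
  "problem_Q S w_lim = \<lparr>
     objective = total_cost S,
     feasible = {z \<in> decisions (horizon S). flow_constraints S z \<and>
       temp_constraints S (x_up_Q S w_lim z) (x_low_Q S w_lim z)} \<rparr>"

definition problem_Q' :: "scenario \<Rightarrow> real \<Rightarrow> decision minimization" where
  "problem_Q' S w_lim = \<lparr>
     objective = total_cost S,
     feasible = {z \<in> decisions (horizon S). flow_constraints S z \<and>
       temp_constraints S (x_up_Q' S w_lim z) (x_low_Q' S w_lim z)} \<rparr>"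

end

theory Submission
  imports Defs
begin

text \<open>For \<open>w_lim = 1\<close> the powers telescope: P - R_up = f(u - rd) and P + R_down =
  f(u + ru). As \<open>fan\<close> is injective, \<open>inv fan\<close> returns exactly the flows u
  - rd and u + ru, so both problems have the same trajectories.\<close>

lemma inj_fan: "inj fan"
proof (rule injI)
  fix x y :: real
  assume eq: "fan x = fan y"
  \<comment> \<open>The cofactor of x - y in \<open>fan x - fan y\<close>; once it is positive,
    equal values force x = y.\<close>
  let ?g = "2588.2 * (x\<^sup>2 + x * y + y\<^sup>2) - 1458 * (x + y) + 630.9"
  \<comment> \<open>With s = x + y, x^2 + xy + y^2 = (3 s^2 + (x - y)^2) / 4. The term -1458 s is
    absorbed in 1458 (s - 1/2)^2, leaving 1941.15 - 1458 = 483.15 on s^2 and the constant 630.9 -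
    364.5 = 266.4.\<close>
  have "0 < 2588.2 / 4 * (x - y)\<^sup>2 + 483.15 * (x + y)\<^sup>2 + 1458 * (x + y - 1 / 2)\<^sup>2 + 266.4"
    by (intro add_nonneg_pos add_nonneg_nonneg mult_nonneg_nonneg zero_le_power2) simp_all
  also have "\<dots> = ?g"
    by (simp add: power2_eq_square field_simps)
  finally have "?g > 0" .
  moreover have "(x - y) * ?g = fan x - fan y"
    by (simp add: fan_def power2_eq_square power3_eq_cube field_simps)
  ultimately show "x = y"
    using eq by simp
qed

theorem proposition3:
  fixes S :: scenario and w_lim :: real
  assumes "w_lim = 1"
  shows "equivalent (problem_Q S w_lim) (problem_Q' S w_lim)"
proof -
  \<comment> \<open>Splitting \<open>z\<close> exposes u, ru, rd; the terms \<open>fan (u k)\<close>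
    then cancel under \<open>inv fan\<close>.\<close>
  have "x_up_Q S 1 z = x_up_Q' S 1 z" for z
    by (cases z) (simp add: x_up_Q_def inv_f_f[OF inj_fan])
  moreover have "x_low_Q S 1 z = x_low_Q' S 1 z" for z
    by (cases z) (simp add: x_low_Q_def inv_f_f[OF inj_fan])
  ultimately show ?thesis
    by (simp add: assms equivalent_def problem_Q_def problem_Q'_def)
qed

end
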